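(* Let $R$ be a commutative ring with unity and let $M$ be a multiplication $R$-module with $\operatorname{Spec}(M)\neq\emptyset$. Then $M$ is a zero dimensional module if and only if every point of $\widetilde{\operatorname{Spec}(M)}$ is an isolated point, that is, $\widetilde{\operatorname{Spec}(M)}$ is a discrete space.
   Context: For a submodule $N$ of an $R$-module $M$, $(N:M)=\{r\in R : rM\subseteq N\}$. A proper submodule $P$ of $M$ is prime if whenever $rm\in P$ with $r\in R$, $m\in M$, then $m\in P$ or $r\in(P:M)$; in this case $(P:M)$ is a prime ideal of $R$. $\operatorname{Spec}(M)$ is the set of all prime submodules of $M$. A subset $T\subseteq R$ is multiplicatively closed if $1\in T$ and $xy\in T$ whenever $x,y\in T$. For a family $\mathcal{S}=\{S_i\}_{i\in I}$ of multiplicatively closed subsets of $R$, $\widetilde{V}(\mathcal{S})=\{P\in\operatorname{Spec}(M) \mid (P:M)\cap S_i\neq\emptyset \text{ for all } i\in I\}$. $\widetilde{\operatorname{Spec}(M)}$ denotes the set $\operatorname{Spec}(M)$ with the topology whose closed sets are exactly the sets $\widetilde{V}(\mathcal{S})$, $\mathcal{S}$ ranging over all families of multiplicatively closed subsets of $R$. A point $x$ of a topological space $X$ is isolated if $\{x\}$ is open in $X$. $M$ is a multiplication module if every submodule $N$ of $M$ has the form $N=IM$ for some ideal $I$ of $R$ (equivalently $N=(N:M)M$). $M$ is zero dimensional if every prime submodule of $M$ is maximal, or equivalently every prime submodule of $M$ is minimal, where maximal and minimal refer to inclusion in $\operatorname{Spec}(M)$. *)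

theory Defs
  imports "HOL-Analysis.Abstract_Topology" "HOL-Algebra.Module" "HOL-Algebra.Ideal" "HOL-Algebra.Generated_Groups"
begin

definition colon :: "('a, 'b) ring_scheme \<Rightarrow> ('a, 'c, 'd) module_scheme \<Rightarrow> 'c set \<Rightarrow> 'a set" where
  "colon R M N = {r \<in> carrier R. \<forall>m \<in> carrier M. r \<odot>\<^bsub>M\<^esub> m \<in> N}"

definition prime_submodule :: "('a, 'b) ring_scheme \<Rightarrow> ('a, 'c, 'd) module_scheme \<Rightarrow> 'c set \<Rightarrow> bool" where
  "prime_submodule R M P \<longleftrightarrow>
     submodule P R M \<and> P \<noteq> carrier M \<and>
     (\<forall>r \<in> carrier R. \<forall>m \<in> carrier M. r \<odot>\<^bsub>M\<^esub> m \<in> P \<longrightarrow> m \<in> P \<or> r \<in> colon R M P)"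

definition Spec :: "('a, 'b) ring_scheme \<Rightarrow> ('a, 'c, 'd) module_scheme \<Rightarrow> 'c set set" where
  "Spec R M = {P. prime_submodule R M P}"

text \<open>The product \<open>I M\<close>: all finite sums of elements \<open>a m\<close> with \<open>a \<in> I\<close> and \<open>m \<in> M\<close>,
  that is, the additive subgroup generated by these elements.\<close>

definition ideal_smult :: "'a set \<Rightarrow> ('a, 'c, 'd) module_scheme \<Rightarrow> 'c set" where
  "ideal_smult I M = generate (add_monoid M) {a \<odot>\<^bsub>M\<^esub> m | a m. a \<in> I \<and> m \<in> carrier M}"

definition multiplication_module :: "('a, 'b) ring_scheme \<Rightarrow> ('a, 'c, 'd) module_scheme \<Rightarrow> bool" where
  "multiplication_module R M \<longleftrightarrow>
     Module.module R M \<and> (\<forall>N. submodule N R M \<longrightarrow> (\<exists>I. ideal I R \<and> N = ideal_smult I M))"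

definition zero_dimensional :: "('a, 'b) ring_scheme \<Rightarrow> ('a, 'c, 'd) module_scheme \<Rightarrow> bool" where
  "zero_dimensional R M \<longleftrightarrow> (\<forall>P \<in> Spec R M. \<forall>Q \<in> Spec R M. P \<subseteq> Q \<longrightarrow> Q = P)"

lemma zero_dimensional_iff_minimal:
  "zero_dimensional R M \<longleftrightarrow> (\<forall>P \<in> Spec R M. \<forall>Q \<in> Spec R M. Q \<subseteq> P \<longrightarrow> Q = P)"
  unfolding zero_dimensional_def by blast

text \<open>A multiplicatively closed subset of \<open>R\<close> is a multiplicative submonoid of \<open>R\<close>.
  Families of such sets are represented by their ranges: the condition defining
  \<open>V_tilde\<close> does not depend on the indexing.\<close>

definition V_tilde :: "('a, 'b) ring_scheme \<Rightarrow> ('a, 'c, 'd) module_scheme \<Rightarrow> 'a set set \<Rightarrow> 'c set set" where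
  "V_tilde R M \<S> = {P \<in> Spec R M. \<forall>S \<in> \<S>. colon R M P \<inter> S \<noteq> {}}"

definition Spec_tilde :: "('a, 'b) ring_scheme \<Rightarrow> ('a, 'c, 'd) module_scheme \<Rightarrow> 'c set topology" where
  "Spec_tilde R M =
     topology (\<lambda>U. \<exists>\<S>. (\<forall>S \<in> \<S>. submonoid S R) \<and> U = Spec R M - V_tilde R M \<S>)"

definition isolated_point :: "'a topology \<Rightarrow> 'a \<Rightarrow> bool" where
  "isolated_point X x \<longleftrightarrow> x \<in> topspace X \<and> openin X {x}"

text \<open>The sets \<open>V_tilde R M \<S>\<close> do satisfy the axioms for closed sets, so that
  \<open>Spec_tilde R M\<close> is the intended topology (\<open>closedin_Spec_tilde\<close>).\<close>

lemma submonoid_compl_colon: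
  assumes M: "Module.module R M" and P: "P \<in> Spec R M"
  shows "submonoid (carrier R - colon R M P) R"
proof -
  interpret M: Module.module R M by (rule M)
  have sub: "submodule P R M" and ne: "P \<noteq> carrier M"
    and pr: "\<And>r m. \<lbrakk>r \<in> carrier R; m \<in> carrier M; r \<odot>\<^bsub>M\<^esub> m \<in> P\<rbrakk> \<Longrightarrow> m \<in> P \<or> r \<in> colon R M P"
    using P unfolding Spec_def prime_submodule_def by auto
  have "P \<subseteq> carrier M" by (rule M.submoduleE(1)[OF sub])
  with ne obtain m where m: "m \<in> carrier M" "m \<notin> P" by blast
  show ?thesis
  proof
    show "carrier R - colon R M P \<subseteq> carrier R" by blast
    show "\<one>\<^bsub>R\<^esub> \<in> carrier R - colon R M P" using m by (auto simp: colon_def)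
  next
    fix x y assume x: "x \<in> carrier R - colon R M P" and y: "y \<in> carrier R - colon R M P"
    from y obtain n where n: "n \<in> carrier M" "y \<odot>\<^bsub>M\<^esub> n \<notin> P" by (auto simp: colon_def)
    have "x \<odot>\<^bsub>M\<^esub> (y \<odot>\<^bsub>M\<^esub> n) \<notin> P"
      using pr[of x "y \<odot>\<^bsub>M\<^esub> n"] x y n by auto
    then have "(x \<otimes>\<^bsub>R\<^esub> y) \<odot>\<^bsub>M\<^esub> n \<notin> P"
      using x y n by (simp add: M.smult_assoc1)
    then show "x \<otimes>\<^bsub>R\<^esub> y \<in> carrier R - colon R M P"
      using x y n by (auto simp: colon_def)
  qed
qed

lemma Spec_tilde_open_iff:
  assumes M: "Module.module R M"
  shows "(\<exists>\<S>. (\<forall>S \<in> \<S>. submonoid S R) \<and> U = Spec R M - V_tilde R M \<S>) \<longleftrightarrow>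
    U \<subseteq> Spec R M \<and> (\<forall>P \<in> U. \<forall>Q \<in> Spec R M. colon R M Q \<subseteq> colon R M P \<longrightarrow> Q \<in> U)"
    (is "?L \<longleftrightarrow> ?R")
proof
  assume ?L
  then show ?R unfolding V_tilde_def by blast
next
  assume R: ?R
  let ?\<S> = "(\<lambda>P. carrier R - colon R M P) ` U"
  have "\<forall>S \<in> ?\<S>. submonoid S R"
    using R submonoid_compl_colon[OF M] by blast
  moreover have "U = Spec R M - V_tilde R M ?\<S>"
  proof
    show "U \<subseteq> Spec R M - V_tilde R M ?\<S>"
      using R by (auto simp: V_tilde_def)
    show "Spec R M - V_tilde R M ?\<S> \<subseteq> U"
    proof
      fix Q assume "Q \<in> Spec R M - V_tilde R M ?\<S>"
      then obtain P where "Q \<in> Spec R M" "P \<in> U" "colon R M Q \<inter> (carrier R - colon R M P) = {}"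
        by (auto simp: V_tilde_def)
      moreover have "colon R M Q \<subseteq> carrier R" by (auto simp: colon_def)
      ultimately show "Q \<in> U" using R by blast
    qed
  qed
  ultimately show ?L by blast
qed

lemma openin_Spec_tilde:
  assumes M: "Module.module R M"
  shows "openin (Spec_tilde R M) U \<longleftrightarrow>
    (\<exists>\<S>. (\<forall>S \<in> \<S>. submonoid S R) \<and> U = Spec R M - V_tilde R M \<S>)"
proof -
  have "istopology (\<lambda>U. \<exists>\<S>. (\<forall>S \<in> \<S>. submonoid S R) \<and> U = Spec R M - V_tilde R M \<S>)"
    unfolding istopology_def Spec_tilde_open_iff[OF M] by blast
  then show ?thesis unfolding Spec_tilde_def by (simp add: topology_inverse')
qed

lemma topspace_Spec_tilde:
  assumes M: "Module.module R M"
  shows "topspace (Spec_tilde R M) = Spec R M"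
  unfolding topspace_def openin_Spec_tilde[OF M] Spec_tilde_open_iff[OF M] by blast

lemma closedin_Spec_tilde:
  assumes M: "Module.module R M"
  shows "closedin (Spec_tilde R M) C \<longleftrightarrow> (\<exists>\<S>. (\<forall>S \<in> \<S>. submonoid S R) \<and> C = V_tilde R M \<S>)"
proof -
  have "V_tilde R M \<S> \<subseteq> Spec R M" for \<S> by (auto simp: V_tilde_def)
  then show ?thesis
    unfolding closedin_def topspace_Spec_tilde[OF M] openin_Spec_tilde[OF M]
    by (metis double_diff subset_refl)
qed

end

theory Submission
  imports Defs
begin

text \<open>The open sets of \<open>Spec_tilde R M\<close> are the sets of prime submodules that are downward closed
  under comparison of colon ideals. In a multiplication module \<open>N = (N : M) M\<close>, so this order is
  inclusion, and a singleton is open iff its point is minimal.\<close>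

lemma colon_mono: "N \<subseteq> N' \<Longrightarrow> colon R M N \<subseteq> colon R M N'"
  by (auto simp: colon_def)

text \<open>With \<open>colon_mono\<close>, this is one half of the adjunction \<open>I M\<close>
  \<subseteq> \<open>N\<close> iff \<open>I\<close> \<subseteq> \<open>(N : M)\<close>; the next
  lemma is the other half.\<close>

lemma subset_colon_ideal_smult:
  assumes "ideal I R"
  shows "I \<subseteq> colon R M (ideal_smult I M)"
  using ideal.Icarr[OF assms] by (auto simp: colon_def ideal_smult_def intro!: generate.incl)

lemma ideal_smult_subset:
  assumes "Module.module R M" and "submodule N R M" and "I \<subseteq> colon R M N"
  shows "ideal_smult I M \<subseteq> N"
proof -
  interpret M: Module.module R M by (rule assms(1))
  have "subgroup N (add_monoid M)"
    using assms(2) by (simp add: submodule_def)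
  moreover have "{a \<odot>\<^bsub>M\<^esub> m | a m. a \<in> I \<and> m \<in> carrier M} \<subseteq> N"
    using assms(3) by (auto simp: colon_def)
  ultimately show ?thesis
    unfolding ideal_smult_def by (intro M.add.generate_subgroup_incl)
qed

text \<open>If \<open>N = I M\<close>, then \<open>I\<close> \<subseteq> \<open>(N : M)\<close>
  \<subseteq> \<open>(N' : M)\<close>, and multiplying \<open>M\<close> by \<open>I\<close> lands in
  \<open>N'\<close>. So passing to colon ideals loses no information about inclusion.\<close>

lemma multiplication_module_colon_subset_iff:
  assumes M: "multiplication_module R M" and N: "submodule N R M" and N': "submodule N' R M"
  shows "colon R M N \<subseteq> colon R M N' \<longleftrightarrow> N \<subseteq> N'"
proof
  assume le: "colon R M N \<subseteq> colon R M N'"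
  obtain I where I: "ideal I R" "N = ideal_smult I M"
    using M N unfolding multiplication_module_def by blast
  then have "I \<subseteq> colon R M N'"
    using subset_colon_ideal_smult[of I R M] le by blast
  then show "N \<subseteq> N'"
    using M N' I(2) ideal_smult_subset unfolding multiplication_module_def by blast
qed (rule colon_mono)

lemma isolated_point_Spec_tilde_iff:
  assumes M: "multiplication_module R M" and P: "P \<in> Spec R M"
  shows "isolated_point (Spec_tilde R M) P \<longleftrightarrow> (\<forall>Q \<in> Spec R M. Q \<subseteq> P \<longrightarrow> Q = P)"
proof -
  have mod: "Module.module R M"
    using M by (simp add: multiplication_module_def)
  have "colon R M Q \<subseteq> colon R M P \<longleftrightarrow> Q \<subseteq> P" if "Q \<in> Spec R M" for Q
    using M that P
    by (intro multiplication_module_colon_subset_iff) (auto simp: Spec_def prime_submodule_def)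
  \<comment> \<open>For \<open>U = {P}\<close>, downward closure says that each prime
    \<open>Q\<close> with \<open>(Q : M)\<close> \<subseteq> \<open>(P : M)\<close> is
    \<open>P\<close> itself.\<close>
  then show ?thesis
    using P unfolding isolated_point_def topspace_Spec_tilde[OF mod] openin_Spec_tilde[OF mod]
      Spec_tilde_open_iff[OF mod] by auto
qed

theorem corollary1:
  fixes R :: "('a, 'b) ring_scheme" and M :: "('a, 'c, 'd) module_scheme"
  assumes "cring R"
    and "Module.module R M"
    and "multiplication_module R M"
    and "Spec R M \<noteq> {}"
  shows "(zero_dimensional R M \<longleftrightarrow> (\<forall>P \<in> Spec R M. isolated_point (Spec_tilde R M) P)) \<and>
         ((\<forall>P \<in> Spec R M. isolated_point (Spec_tilde R M) P) \<longleftrightarrow>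
           Spec_tilde R M = discrete_topology (Spec R M))"
proof
  \<comment> \<open>Isolation of all points makes every prime minimal. Over all pairs this is the
    same as every prime being maximal: no two distinct primes are comparable.\<close>
  show "zero_dimensional R M \<longleftrightarrow> (\<forall>P \<in> Spec R M. isolated_point (Spec_tilde R M) P)"
    using isolated_point_Spec_tilde_iff[OF assms(3)] by (simp add: zero_dimensional_iff_minimal)
  \<comment> \<open>The equation is turned around to fit \<open>discrete_topology_unique\<close>,
    which tests discreteness on singletons.\<close>
  have "discrete_topology (Spec R M) = Spec_tilde R M \<longleftrightarrow>
      (\<forall>P \<in> Spec R M. isolated_point (Spec_tilde R M) P)"
    using topspace_Spec_tilde[OF assms(2)]
    by (auto simp: discrete_topology_unique isolated_point_def)
  then show "(\<forall>P \<in> Spec R M. isolated_point (Spec_tilde R M) P) \<longleftrightarrow>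
      Spec_tilde R M = discrete_topology (Spec R M)"
    by (auto simp: eq_commute)
qed

end
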